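(* Let $c \in \mathfrak{C}_+$. Then, for any measure $$d\mu =\frac{P}{Q}\,dm,\quad P, Q \in \bar{\mathfrak{P}}_+\setminus \{0\},$$ satisfying the moment condition $c_{\mathbf{k}}=\int_{\mathbb{T}^d}e^{i(\mathbf{k},\boldsymbol{\theta})}\,d\mu(\boldsymbol{\theta})$ for all $\mathbf{k}\in\Lambda$, $Q$ is the unique minimizer over $\bar{\mathfrak{P}}_+$ of the functional $$\mathbb{J}_P(\tilde Q) = \langle c, \tilde q \rangle - \int_{\mathbb{T}^d} P(e^{i\boldsymbol{\theta}}) \log \tilde Q(e^{i\boldsymbol{\theta}})\, dm(\boldsymbol{\theta}).$$
   Context: Let $d\ge 1$, $\mathbb{T}=(-\pi,\pi]$, $\boldsymbol{\theta}=(\theta_1,\dots,\theta_d)$, $e^{i\boldsymbol{\theta}}=(e^{i\theta_1},\dots,e^{i\theta_d})$, $(\mathbf{k},\boldsymbol{\theta})=\sum_{j=1}^d k_j\theta_j$, and $dm(\boldsymbol{\theta})=(1/2\pi)^d\prod_{j=1}^d d\theta_j$. The index set $\Lambda\subset\mathbb{Z}^d$ is finite with $0\in\Lambda$ and $-\Lambda=\Lambda$. Trigonometric polynomials are $P(e^{i\boldsymbol{\theta}})=\sum_{\mathbf{k}\in\Lambda}p_{\mathbf{k}}e^{-i(\mathbf{k},\boldsymbol{\theta})}$ with $p_{-\mathbf{k}}=\bar p_{\mathbf{k}}$ (real valued), identified with their coefficient vector $p=(p_{\mathbf{k}})_{\mathbf{k}\in\Lambda}$ (similarly $Q\leftrightarrow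 q$, $\tilde Q\leftrightarrow\tilde q$). $\mathfrak{P}_+$ is the convex cone of such polynomials that are positive for all $\boldsymbol{\theta}\in\mathbb{T}^d$; $\bar{\mathfrak{P}}_+$ is its closure (nonnegative polynomials). Sequences $c=(c_{\mathbf{k}})_{\mathbf{k}\in\Lambda}$ are complex with $c_{-\mathbf{k}}=\bar c_{\mathbf{k}}$; $\langle c,p\rangle=\sum_{\mathbf{k}\in\Lambda}c_{\mathbf{k}}\bar p_{\mathbf{k}}$. $\mathfrak{C}_+=\{c\mid\langle c,p\rangle>0\text{ for all }P\in\bar{\mathfrak{P}}_+\setminus\{0\}\}$. By convention $\mathbb{J}_P(\tilde Q)=+\infty$ for $\tilde Q\equiv0$. Measures $d\mu$ are understood to be nonnegative and bounded (so $P/Q$ is integrable). *)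

theory Defs
  imports "HOL-Analysis.Analysis"
begin

text \<open>
  The dimension \<open>d \<ge> 1\<close> is the cardinality of the finite index type \<open>'d\<close>. A family
  indexed by \<open>\<Lambda>\<close> is encoded as a function on all of \<open>int^'d\<close> that vanishes outside
  \<open>\<Lambda>\<close>, so that equality of families is equality of functions, and a trigonometric
  polynomial is identified with its coefficient family.
\<close>

definition torus :: "(real^'d) set"
  where "torus = {\<theta>. \<forall>j. - pi < \<theta> $ j \<and> \<theta> $ j \<le> pi}"

definition dm :: "(real^'d) measure"
  where "dm = density (restrict_space lborel torus) (\<lambda>_. ennreal ((1 / (2 * pi)) ^ CARD('d)))"

definition pairing :: "int^'d \<Rightarrow> real^'d \<Rightarrow> real"
  where "pairing k \<theta> = (\<Sum>j\<in>UNIV. of_int (k $ j) * \<theta> $ j)"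

definition hermitian_families :: "(int^'d) set \<Rightarrow> (int^'d \<Rightarrow> complex) set"
  where "hermitian_families \<Lambda> =
    {p. (\<forall>k. k \<notin> \<Lambda> \<longrightarrow> p k = 0) \<and> (\<forall>k\<in>\<Lambda>. p (- k) = cnj (p k))}"

definition trig_poly :: "(int^'d) set \<Rightarrow> (int^'d \<Rightarrow> complex) \<Rightarrow> real^'d \<Rightarrow> complex"
  where "trig_poly \<Lambda> p \<theta> = (\<Sum>k\<in>\<Lambda>. p k * cis (- pairing k \<theta>))"

definition cinner :: "(int^'d) set \<Rightarrow> (int^'d \<Rightarrow> complex) \<Rightarrow> (int^'d \<Rightarrow> complex) \<Rightarrow> complex"
  where "cinner \<Lambda> c p = (\<Sum>k\<in>\<Lambda>. c k * cnj (p k))"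

text \<open>
  For \<open>- \<Lambda> = \<Lambda>\<close> both \<^const>\<open>trig_poly\<close> and \<^const>\<open>cinner\<close> are real on
  \<^const>\<open>hermitian_families\<close>, which justifies taking real parts below.
\<close>

lemma trig_poly_real:
  assumes "uminus ` \<Lambda> = \<Lambda>" "p \<in> hermitian_families \<Lambda>"
  shows "trig_poly \<Lambda> p \<theta> \<in> \<real>"
proof -
  have pm: "pairing (- k) \<theta> = - pairing k \<theta>" for k
    by (simp add: pairing_def sum_negf)
  have "cnj (trig_poly \<Lambda> p \<theta>) = (\<Sum>k\<in>\<Lambda>. p (- k) * cis (- pairing (- k) \<theta>))"
    unfolding trig_poly_def cnj_sum using assms(2)
    by (intro sum.cong) (auto simp: hermitian_families_def cis_cnj pm)
  also have "\<dots> = (\<Sum>k\<in>uminus ` \<Lambda>. p k * cis (- pairing k \<theta>))"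
    by (subst sum.reindex) (auto simp: inj_on_def)
  finally show ?thesis
    using assms(1) by (simp add: trig_poly_def Reals_cnj_iff)
qed

lemma cinner_real:
  assumes "uminus ` \<Lambda> = \<Lambda>" "c \<in> hermitian_families \<Lambda>" "p \<in> hermitian_families \<Lambda>"
  shows "cinner \<Lambda> c p \<in> \<real>"
proof -
  have "cnj (cinner \<Lambda> c p) = (\<Sum>k\<in>\<Lambda>. c (- k) * cnj (p (- k)))"
    unfolding cinner_def cnj_sum using assms(2,3)
    by (intro sum.cong) (auto simp: hermitian_families_def)
  also have "\<dots> = (\<Sum>k\<in>uminus ` \<Lambda>. c k * cnj (p k))"
    by (subst sum.reindex) (auto simp: inj_on_def)
  finally show ?thesis
    using assms(1) by (simp add: cinner_def Reals_cnj_iff)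
qed

definition pos_polys :: "(int^'d) set \<Rightarrow> (int^'d \<Rightarrow> complex) set"
  where "pos_polys \<Lambda> = {p \<in> hermitian_families \<Lambda>. \<forall>\<theta>\<in>torus. Re (trig_poly \<Lambda> p \<theta>) > 0}"

text \<open>
  The closure is taken in the topology of pointwise convergence of coefficients, which for
  finite \<open>\<Lambda>\<close> is the usual topology of the finite-dimensional space of coefficient vectors.
\<close>

definition closed_pos_polys :: "(int^'d) set \<Rightarrow> (int^'d \<Rightarrow> complex) set"
  where "closed_pos_polys \<Lambda> = closure (pos_polys \<Lambda>)"

lemma closed_pos_polys_eq_nonneg:
  fixes \<Lambda> :: "(int^'d) set"
  assumes "finite \<Lambda>" "0 \<in> \<Lambda>"
  shows "closed_pos_polys \<Lambda> =
    {p \<in> hermitian_families \<Lambda>. \<forall>\<theta>\<in>torus. Re (trig_poly \<Lambda> p \<theta>) \<ge> 0}" (is "_ = ?N")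
proof
  have N: "?N = (\<Inter>k\<in>- \<Lambda>. {p. p k = 0}) \<inter> (\<Inter>k\<in>\<Lambda>. {p. p (- k) = cnj (p k)})
      \<inter> (\<Inter>\<theta>\<in>torus. {p. Re (trig_poly \<Lambda> p \<theta>) \<ge> 0})"
    by (auto simp: hermitian_families_def)
  have "closed ((\<Inter>k\<in>- \<Lambda>. {p. p k = 0}) \<inter> (\<Inter>k\<in>\<Lambda>. {p. p (- k) = cnj (p k)})
      \<inter> (\<Inter>\<theta>\<in>torus. {p. Re (trig_poly \<Lambda> p \<theta>) \<ge> 0}))"
    unfolding trig_poly_def
    by (intro closed_Int closed_INT ballI closed_Collect_eq closed_Collect_le
        continuous_intros continuous_on_product_coordinates)
  then have "closed ?N"
    by (simp only: N)
  then show "closed_pos_polys \<Lambda> \<subseteq> ?N"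
    unfolding closed_pos_polys_def
    by (rule closure_minimal[rotated]) (auto simp: pos_polys_def intro: less_imp_le)
next
  show "?N \<subseteq> closed_pos_polys \<Lambda>"
  proof
    fix p assume p: "p \<in> ?N"
    define g where "g s = (\<lambda>k. p k + (if k = 0 then complex_of_real s else 0))" for s
    have "trig_poly \<Lambda> (g s) \<theta> = trig_poly \<Lambda> p \<theta> + of_real s" for s \<theta>
    proof -
      have "trig_poly \<Lambda> (g s) \<theta> = trig_poly \<Lambda> p \<theta>
          + (\<Sum>k\<in>\<Lambda>. if k = 0 then of_real s * cis (- pairing k \<theta>) else 0)"
        unfolding trig_poly_def g_def sum.distrib[symmetric]
        by (intro sum.cong) (auto simp: distrib_right)
      then show ?thesis
        using assms by (simp add: pairing_def)
    qed
    moreover have "g s \<in> hermitian_families \<Lambda>" for s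
      using p assms(2) by (auto simp: hermitian_families_def g_def)
    ultimately have "g ` {0<..} \<subseteq> pos_polys \<Lambda>"
      using p by (auto simp: pos_polys_def intro!: add_nonneg_pos)
    then have "g ` {0<..} \<subseteq> closure (pos_polys \<Lambda>)"
      using closure_subset by blast
    moreover have "continuous_on (closure {0<..}) (\<lambda>s. g s k)" for k
      unfolding g_def by (cases "k = 0") (auto intro!: continuous_intros)
    then have "continuous_on (closure {0<..}) g"
      by (rule continuous_on_coordinatewise_then_product)
    ultimately have "g ` closure {0<..} \<subseteq> closure (pos_polys \<Lambda>)"
      by (intro image_closure_subset) auto
    moreover have "g 0 = p" "(0::real) \<in> closure {0<..}"
      by (auto simp: g_def)
    ultimately show "p \<in> closed_pos_polys \<Lambda>"
      unfolding closed_pos_polys_def by blast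
  qed
qed

definition dual_cone :: "(int^'d) set \<Rightarrow> (int^'d \<Rightarrow> complex) set"
  where "dual_cone \<Lambda> = {c \<in> hermitian_families \<Lambda>.
    \<forall>p \<in> closed_pos_polys \<Lambda> - {\<lambda>_. 0}. Re (cinner \<Lambda> c p) > 0}"

text \<open>
  Lebesgue integral with values in the extended reals. It is used only for
  \<open>P log Q\<close>, whose positive part is bounded, so \<open>\<infinity> - \<infinity>\<close> does not occur;
  unlike the Bochner integral it does not fall back to 0 if the negative part diverges.
\<close>

definition ext_integral :: "'a measure \<Rightarrow> ('a \<Rightarrow> real) \<Rightarrow> ereal"
  where "ext_integral M f =
    enn2ereal (\<integral>\<^sup>+ x. ennreal (f x) \<partial>M) - enn2ereal (\<integral>\<^sup>+ x. ennreal (- f x) \<partial>M)"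

text \<open>
  The zero set of a nonzero trigonometric polynomial is a null set, so the library
  convention \<open>ln 0 = 0\<close> has no effect on the value of the integral.
\<close>

definition J :: "(int^'d) set \<Rightarrow> (int^'d \<Rightarrow> complex) \<Rightarrow> (int^'d \<Rightarrow> complex)
    \<Rightarrow> (int^'d \<Rightarrow> complex) \<Rightarrow> ereal"
  where "J \<Lambda> c p q = (if q = (\<lambda>_. 0) then \<infinity>
    else ereal (Re (cinner \<Lambda> c q))
      - ext_integral dm (\<lambda>\<theta>. Re (trig_poly \<Lambda> p \<theta>) * ln (Re (trig_poly \<Lambda> q \<theta>))))"

text \<open>
  The measure \<open>P/Q dm\<close>. Division by zero in \<open>P/Q\<close> again only concerns a null set.
\<close>

definition rational_measure ::
    "(int^'d) set \<Rightarrow> (int^'d \<Rightarrow> complex) \<Rightarrow> (int^'d \<Rightarrow> complex) \<Rightarrow> (real^'d) measure"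
  where "rational_measure \<Lambda> p q =
    density dm (\<lambda>\<theta>. ennreal (Re (trig_poly \<Lambda> p \<theta>) / Re (trig_poly \<Lambda> q \<theta>)))"

end

theory Submission
  imports Defs
begin

text \<open>
  The moment conditions give \<open>\<langle>c, r\<rangle> = \<integral> (P/Q) R dm\<close> for every polynomial \<open>R\<close>, so that
  \<open>J(R) - J(Q) = \<integral> P (R/Q - 1 - ln (R/Q)) dm\<close>. The integrand is nonnegative and vanishes only
  where \<open>P = 0\<close> or \<open>R = Q\<close>, which is a null set if \<open>R \<noteq> Q\<close>, since zero sets of
  nonzero trigonometric polynomials are null sets. \<open>J(Q)\<close> is finite because
  \<open>P |ln Q| \<le> P Q + P/Q\<close>, and \<open>J(R) = \<infinity>\<close> if \<open>P ln R\<close> is not integrable.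
  For the null sets, restrict the polynomial to lines in a direction that separates the
  frequencies: it becomes an exponential sum in one variable, which has countably many zeros.
\<close>

section \<open>Zero sets of exponential sums and of trigonometric polynomials\<close>

text \<open>
  Dividing by one of the exponentials makes one term constant, so the derivative has fewer
  terms. Zeros of the sum can accumulate only at zeros of that derivative.
\<close>

lemma countable_zeros_exp_sum:
  fixes a w :: "'i \<Rightarrow> complex"
  assumes "finite A" "A \<noteq> {}" "inj_on w A" "\<And>k. k \<in> A \<Longrightarrow> a k \<noteq> 0"
  shows "countable {z. (\<Sum>k\<in>A. a k * exp (w k * z)) = 0}"
  using assms
proof (induction A arbitrary: a w rule: finite_ne_induct)
  case (singleton x)
  then show ?case by simp
next
  case (insert x F)
  define b where "b k = a k * (w k - w x)" for k
  \<comment> \<open>\<open>g\<close> is the sum divided by \<open>exp (w x * z)\<close>, and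
    \<open>h\<close> is its derivative. The coefficients \<open>b k\<close> stay nonzero because the
    frequencies are distinct.\<close>
  define g where "g z = a x + (\<Sum>k\<in>F. a k * exp ((w k - w x) * z))" for z
  define h where "h z = (\<Sum>k\<in>F. b k * exp ((w k - w x) * z))" for z
  have "w k \<noteq> w x" if "k \<in> F" for k
    using insert.prems(1) insert.hyps(3) that by (auto simp: inj_on_def)
  then have h0: "countable {z. h z = 0}"
    unfolding h_def using insert.prems
    by (intro insert.IH) (auto simp: b_def inj_on_def)
  have deriv: "(g has_field_derivative h z) (at z)" for z
    unfolding g_def h_def b_def
    by (auto intro!: derivative_eq_intros sum.cong simp: algebra_simps)
  have "\<forall>\<^sub>F y in at z. g y \<noteq> 0" if "h z \<noteq> 0" for z
  proof (cases "g z = 0")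
    \<comment> \<open>At a zero of \<open>g\<close> the difference quotient is
      \<open>g y / (y - z)\<close> and tends to \<open>h z\<close>, which is nonzero, so the zero is
      isolated.\<close>
    case True
    have "((\<lambda>y. (g y - g z) / (y - z)) \<longlongrightarrow> h z) (at z)"
      using deriv[of z] by (simp add: has_field_derivative_iff)
    then have "\<forall>\<^sub>F y in at z. (g y - g z) / (y - z) \<noteq> 0"
      using that by (rule tendsto_imp_eventually_ne)
    then show ?thesis
      by eventually_elim (auto simp: True)
  next
    case False
    have "(g \<longlongrightarrow> g z) (at z)"
      using DERIV_isCont[OF deriv] by (simp add: isCont_def)
    then show ?thesis
      using False by (rule tendsto_imp_eventually_ne)
  qed
  moreover have op: "open {z. h z \<noteq> 0}"
    unfolding h_def by (intro open_Collect_neq continuous_intros)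
  \<comment> \<open>Where \<open>h\<close> does not vanish, the zeros of \<open>g\<close> have no
    limit point, hence are countable there. All other zeros of \<open>g\<close> are zeros of
    \<open>h\<close>, which the induction hypothesis counts.\<close>
  ultimately have "{z. g z = 0} sparse_in {z. h z \<noteq> 0}"
    by (auto simp: sparse_in_open islimpt_iff_eventually)
  from sparse_imp_countable[OF op this] h0
  have "countable ({z. h z \<noteq> 0} \<inter> {z. g z = 0} \<union> {z. h z = 0})"
    by (rule countable_Un)
  moreover have "(\<Sum>k\<in>insert x F. a k * exp (w k * z)) = exp (w x * z) * g z" for z
    using insert.hyps unfolding g_def
    by (simp add: ring_distribs sum_distrib_left mult_ac flip: exp_add)
  ultimately show ?case
    by (elim countable_subset[rotated]) auto
qed

text \<open>By Fubini, almost every translate of \<open>S\<close> along \<open>v\<close> is null.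
  One such translate is enough, since Lebesgue measure is translation invariant.\<close>

lemma null_sets_if_null_on_lines:
  fixes S :: "'a::euclidean_space set"
  assumes [measurable]: "S \<in> sets borel"
    and line: "\<And>x. AE t in lborel. t *\<^sub>R v + x \<notin> S"
  shows "S \<in> null_sets lborel"
proof -
  have [measurable]: "(\<lambda>z::'a \<times> real. snd z *\<^sub>R v + fst z) \<in> borel_measurable (lborel \<Otimes>\<^sub>M lborel)"
    by measurable
  have "AE t in lborel. AE x in lborel. t *\<^sub>R v + x \<notin> S"
  proof (subst lborel_pair.AE_commute[symmetric])
    show "{z \<in> space (lborel \<Otimes>\<^sub>M lborel). snd z *\<^sub>R v + fst z \<notin> S} \<in> sets (lborel \<Otimes>\<^sub>M lborel)"
      by measurable
  qed (use line in auto)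
  \<comment> \<open>The line has nonzero measure, so a property of almost every \<open>t\<close>
    holds for some \<open>t\<close>.\<close>
  moreover have "ae_filter (lborel :: real measure) \<noteq> bot"
    by (simp add: ae_filter_eq_bot_iff)
  ultimately obtain t where "AE x in lborel. t *\<^sub>R v + x \<notin> S"
    by (metis (mono_tags, lifting) eventually_happens')
  then have "AE x in distr lborel borel ((+) (t *\<^sub>R v)). x \<notin> S"
    by (subst AE_distr_iff) auto
  then show ?thesis
    unfolding lborel_distr_plus by (subst AE_iff_null_sets) auto
qed

text \<open>Each pair of distinct points excludes only the hyperplane orthogonal to their
  difference. Finitely many hyperplanes are negligible and cannot cover the space.\<close>

lemma exists_separating_direction:
  fixes A :: "'a::euclidean_space set"
  assumes "finite A"
  shows "\<exists>v. inj_on (\<lambda>x. x \<bullet> v) A"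
proof -
  have "negligible (\<Union>((\<lambda>(x, y). {v. (x - y) \<bullet> v = 0}) ` (A \<times> A - Id)))"
    using assms by (intro negligible_Union) (auto intro!: negligible_hyperplane)
  then have "\<Union>((\<lambda>(x, y). {v. (x - y) \<bullet> v = 0}) ` (A \<times> A - Id)) \<noteq> UNIV"
    using non_negligible_UNIV by metis
  then obtain v where "\<And>x y. x \<in> A \<Longrightarrow> y \<in> A \<Longrightarrow> x \<noteq> y \<Longrightarrow> (x - y) \<bullet> v \<noteq> 0"
    by blast
  then show ?thesis
    by (auto simp: inj_on_def inner_diff_left intro!: exI[of _ v])
qed

lemma continuous_on_trig_poly [continuous_intros]: "continuous_on X (trig_poly \<Lambda> p)"
  unfolding trig_poly_def pairing_def by (intro continuous_intros)

lemma null_sets_zeros_trig_poly: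
  fixes \<Lambda> :: "(int^'d) set"
  assumes "finite \<Lambda>" "k \<in> \<Lambda>" "p k \<noteq> 0"
  shows "{\<theta>. trig_poly \<Lambda> p \<theta> = 0} \<in> null_sets lborel"
proof -
  \<comment> \<open>The restriction to \<open>A\<close> supplies the nonzero coefficients that
    \<open>countable_zeros_exp_sum\<close> requires.\<close>
  define A where "A = {k\<in>\<Lambda>. p k \<noteq> 0}"
  define vec where "vec k = (\<chi> j. real_of_int (k $ j))" for k :: "int^'d"
  have pairing: "pairing k \<theta> = vec k \<bullet> \<theta>" for k \<theta>
    by (simp add: pairing_def vec_def inner_vec_def)
  have "inj vec"
    by (auto simp: vec_def inj_on_def vec_eq_iff)
  obtain v where "inj_on (\<lambda>x. x \<bullet> v) (vec ` A)"
    using exists_separating_direction[of "vec ` A"] assms by (auto simp: A_def)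
  then have inj: "inj_on (\<lambda>k. vec k \<bullet> v) A"
    using \<open>inj vec\<close> by (auto simp: inj_on_def)
  show ?thesis
  proof (rule null_sets_if_null_on_lines[where v = v])
    show "{\<theta>. trig_poly \<Lambda> p \<theta> = 0} \<in> sets borel"
      by (intro borel_closed closed_Collect_eq continuous_intros)
    fix \<theta> :: "real^'d"
    \<comment> \<open>The base point \<open>\<theta>\<close> is absorbed into the coefficients,
      which leaves a sum in \<open>z\<close> with distinct frequencies. The line itself corresponds
      to real \<open>z\<close>.\<close>
    let ?G = "\<lambda>z. \<Sum>k\<in>A. (p k * cis (- pairing k \<theta>)) * exp (- \<i> * of_real (vec k \<bullet> v) * z)"
    have "trig_poly \<Lambda> p (t *\<^sub>R v + \<theta>) = ?G (of_real t)" for t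
    proof -
      have "trig_poly \<Lambda> p (t *\<^sub>R v + \<theta>) = (\<Sum>k\<in>A. p k * cis (- pairing k (t *\<^sub>R v + \<theta>)))"
        unfolding trig_poly_def A_def using assms(1) by (intro sum.mono_neutral_right) auto
      also have "\<dots> = ?G (of_real t)"
        by (intro sum.cong)
          (auto simp: pairing inner_add_right cis_conv_exp exp_add[symmetric] algebra_simps)
      finally show ?thesis .
    qed
    moreover have "countable {z. ?G z = 0}"
      using assms inj by (intro countable_zeros_exp_sum) (auto simp: A_def inj_on_def)
    \<comment> \<open>Countability passes from the complex zeros to the real parameters because
      \<open>complex_of_real\<close> is injective.\<close>
    then have "countable (complex_of_real ` (complex_of_real -` {z. ?G z = 0}))"
      by (rule countable_subset[rotated]) blast
    then have "countable (complex_of_real -` {z. ?G z = 0})"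
      by (rule countable_image_inj_on) (simp add: inj_on_def)
    ultimately have "{t. trig_poly \<Lambda> p (t *\<^sub>R v + \<theta>) = 0} \<in> null_sets lborel"
      by (intro countable_imp_null_set_lborel) (simp add: vimage_def)
    then show "AE t in lborel. t *\<^sub>R v + \<theta> \<notin> {\<theta>. trig_poly \<Lambda> p \<theta> = 0}"
      by (auto dest: AE_not_in)
  qed
qed


section \<open>The normalized measure on the torus\<close>

lemma sets_torus [measurable]: "torus \<in> sets borel"
proof -
  have "torus = (\<Inter>j. {\<theta>. - pi < \<theta> $ j} \<inter> {\<theta>. \<theta> $ j \<le> pi})"
    by (auto simp: torus_def)
  also have "\<dots> \<in> sets borel"
    by (intro sets.finite_INT sets.Int borel_open borel_closed open_Collect_less
        closed_Collect_le continuous_intros) auto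
  finally show ?thesis .
qed

lemma space_dm [simp]: "space dm = torus"
  by (simp add: dm_def space_restrict_space)

lemma borel_measurable_dm:
  "f \<in> borel_measurable borel \<Longrightarrow> f \<in> borel_measurable dm"
  by (simp add: dm_def measurable_restrict_space1)

lemma AE_dm:
  assumes "AE \<theta> in lborel. P \<theta>"
  shows "AE \<theta> in dm. P \<theta>"
  unfolding dm_def using assms by (subst AE_density) (auto simp: AE_restrict_space_iff)

text \<open>The half-open cube contains an open box of positive volume and lies in a closed box of
  finite volume.\<close>

lemma emeasure_dm_torus:
  "emeasure (dm :: (real^'d) measure) torus \<noteq> 0" "emeasure (dm :: (real^'d) measure) torus \<noteq> \<infinity>"
proof -
  have eq: "emeasure (dm :: (real^'d) measure) torus =
      ennreal ((1 / (2 * pi)) ^ CARD('d)) * emeasure lborel (torus :: (real^'d) set)"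
    unfolding dm_def by (subst emeasure_density_const)
      (auto simp: sets_restrict_space_iff emeasure_restrict_space)
  have "emeasure lborel (box (- (\<chi> j. pi)) (\<chi> j. pi) :: (real^'d) set)
      \<le> emeasure lborel (torus :: (real^'d) set)"
    by (intro emeasure_mono) (auto simp: torus_def mem_box_cart less_imp_le)
  moreover have "emeasure lborel (box (- (\<chi> j. pi)) (\<chi> j. pi) :: (real^'d) set) > 0"
    by (auto simp: emeasure_lborel_box_eq Basis_vec_def inner_axis intro!: prod_pos)
  ultimately have "emeasure lborel (torus :: (real^'d) set) > 0"
    by order
  then show "emeasure (dm :: (real^'d) measure) torus \<noteq> 0"
    by (auto simp: eq)
  have "emeasure lborel (torus :: (real^'d) set)
      \<le> emeasure lborel (cbox (- (\<chi> j. pi)) (\<chi> j. pi) :: (real^'d) set)"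
    by (intro emeasure_mono) (auto simp: torus_def mem_box_cart less_imp_le)
  then have "emeasure lborel (torus :: (real^'d) set) < \<infinity>"
    using emeasure_lborel_cbox_finite order_le_less_trans by (metis infinity_ennreal_def)
  then show "emeasure (dm :: (real^'d) measure) torus \<noteq> \<infinity>"
    by (auto simp: eq ennreal_mult_eq_top_iff)
qed

text \<open>Turns a contradiction almost everywhere into a contradiction; this is what makes the
  final inequality strict.\<close>

lemma not_AE_dm_False: "\<not> (AE \<theta> in (dm :: (real^'d) measure). False)"
  using emeasure_dm_torus(1) by (simp add: ae_filter_eq_bot_iff trivial_limit_def[symmetric])

interpretation dm: finite_measure dm
  by standard (use emeasure_dm_torus(2) in simp)

section \<open>Evaluation of the extended integral\<close>

lemma ext_integral_eq_integral:
  assumes "integrable M f"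
  shows "ext_integral M f = ereal (integral\<^sup>L M f)"
  using assms
  by (cases rule: integrableE) (auto simp: ext_integral_def enn2ereal_ennreal)

text \<open>The majorant \<open>g\<close> keeps the positive part of \<open>f\<close> finite, so
  failure of integrability can only come from the negative part.\<close>

lemma ext_integral_eq_MInfty:
  assumes "f \<in> borel_measurable M" "integrable M g" "\<And>x. x \<in> space M \<Longrightarrow> f x \<le> g x"
    and "\<not> integrable M f"
  shows "ext_integral M f = - \<infinity>"
proof -
  have "(\<integral>\<^sup>+x. ennreal (f x) \<partial>M) \<le> (\<integral>\<^sup>+x. ennreal (g x) \<partial>M)"
    by (intro nn_integral_mono ennreal_leI assms(3))
  then have "(\<integral>\<^sup>+x. ennreal (f x) \<partial>M) \<noteq> \<infinity>"
    using assms(2) by (auto simp: real_integrable_def top_unique)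
  moreover from this have "(\<integral>\<^sup>+x. ennreal (- f x) \<partial>M) = \<infinity>"
    using assms(1,4) by (auto simp: real_integrable_def)
  ultimately show ?thesis
    by (cases "\<integral>\<^sup>+x. ennreal (f x) \<partial>M") (auto simp: ext_integral_def enn2ereal_ennreal)
qed

section \<open>Positivity and integrability of trigonometric polynomials on the torus\<close>

lemma norm_trig_poly_le: "norm (trig_poly \<Lambda> p \<theta>) \<le> (\<Sum>k\<in>\<Lambda>. norm (p k))"
  unfolding trig_poly_def by (rule order_trans[OF norm_sum]) (simp add: norm_mult)

lemma trig_poly_diff:
  "trig_poly \<Lambda> (\<lambda>k. p k - q k) \<theta> = trig_poly \<Lambda> p \<theta> - trig_poly \<Lambda> q \<theta>"
  by (simp add: trig_poly_def left_diff_distrib sum_subtractf)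


lemma AE_trig_poly_neq_0:
  fixes \<Lambda> :: "(int^'d) set"
  assumes "finite \<Lambda>" "r \<in> hermitian_families \<Lambda>" "r \<noteq> (\<lambda>_. 0)"
  shows "AE \<theta> in dm. trig_poly \<Lambda> r \<theta> \<noteq> 0"
proof -
  obtain k where "k \<in> \<Lambda>" "r k \<noteq> 0"
    using assms(2,3) by (auto simp: hermitian_families_def fun_eq_iff)
  then show ?thesis
    using null_sets_zeros_trig_poly[OF assms(1), of k r] by (intro AE_dm) (auto dest: AE_not_in)
qed

text \<open>Combines nonnegativity with the null zero set. Since the values are real, a nonzero
  value has a nonzero real part.\<close>

lemma AE_closed_pos_poly_pos:
  fixes \<Lambda> :: "(int^'d) set"
  assumes "finite \<Lambda>" "0 \<in> \<Lambda>" "uminus ` \<Lambda> = \<Lambda>" "r \<in> closed_pos_polys \<Lambda> - {\<lambda>_. 0}"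
  shows "AE \<theta> in dm. 0 < Re (trig_poly \<Lambda> r \<theta>)"
proof -
  have r: "r \<in> hermitian_families \<Lambda>" "\<And>\<theta>. \<theta> \<in> torus \<Longrightarrow> 0 \<le> Re (trig_poly \<Lambda> r \<theta>)"
    using assms by (auto simp: closed_pos_polys_eq_nonneg)
  have "AE \<theta> in dm. \<theta> \<in> torus"
    by (intro AE_I2) simp
  moreover have "AE \<theta> in dm. trig_poly \<Lambda> r \<theta> \<noteq> 0"
    using assms r by (intro AE_trig_poly_neq_0) auto
  ultimately show ?thesis
  proof eventually_elim
    case (elim \<theta>)
    have "Re (trig_poly \<Lambda> r \<theta>) \<noteq> 0"
      using elim trig_poly_real[OF assms(3) r(1), of \<theta>] by (auto elim!: Reals_cases)
    then show ?case
      using r(2)[OF elim(1)] by simp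
  qed
qed

lemma borel_measurable_trig_poly [measurable]: "trig_poly \<Lambda> p \<in> borel_measurable dm"
  by (intro borel_measurable_dm borel_measurable_continuous_onI continuous_intros)

text \<open>A trigonometric polynomial is bounded by the sum of the moduli of its
  coefficients.\<close>

lemma integrable_mult_trig_poly:
  fixes w :: "real^'d \<Rightarrow> real"
  assumes "integrable M w" "trig_poly \<Lambda> r \<in> borel_measurable M"
  shows "integrable M (\<lambda>\<theta>. w \<theta> * Re (trig_poly \<Lambda> r \<theta>))"
proof (rule Bochner_Integration.integrable_bound)
  show "integrable M (\<lambda>\<theta>. w \<theta> * (\<Sum>k\<in>\<Lambda>. norm (r k)))"
    using assms by simp
  have "\<bar>Re (trig_poly \<Lambda> r \<theta>)\<bar> \<le> \<bar>\<Sum>k\<in>\<Lambda>. norm (r k)\<bar>" for \<theta>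
    using norm_trig_poly_le[of \<Lambda> r \<theta>] abs_Re_le_cmod[of "trig_poly \<Lambda> r \<theta>"] by linarith
  then show "AE \<theta> in M. norm (w \<theta> * Re (trig_poly \<Lambda> r \<theta>)) \<le> norm (w \<theta> * (\<Sum>k\<in>\<Lambda>. norm (r k)))"
    by (auto simp: abs_mult intro!: mult_left_mono)
qed (use assms in measurable)

section \<open>Moments and the strict inequality for \<open>J\<close>\<close>

lemma Re_cinner_moments:
  fixes w :: "real^'d \<Rightarrow> real"
  assumes w: "integrable dm w" "AE \<theta> in dm. 0 \<le> w \<theta>"
    and c: "\<And>k. k \<in> \<Lambda> \<Longrightarrow> c k = (\<integral>\<theta>. cis (pairing k \<theta>) \<partial>density dm w)"
  shows "Re (cinner \<Lambda> c r) = (\<integral>\<theta>. w \<theta> * Re (trig_poly \<Lambda> r \<theta>) \<partial>dm)"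
proof -
  have [measurable]: "(\<lambda>\<theta>. cis (pairing k \<theta>)) \<in> borel_measurable dm" for k :: "int^'d"
  proof -
    have "continuous_on UNIV (\<lambda>\<theta>. cis (pairing k \<theta>))"
      unfolding pairing_def by (intro continuous_intros)
    then show ?thesis
      by (intro borel_measurable_dm borel_measurable_continuous_onI)
  qed
  have [measurable]: "w \<in> borel_measurable dm"
    using w(1) by simp
  have int: "integrable dm (\<lambda>\<theta>. of_real (w \<theta>) * cis (pairing k \<theta>))" for k
    using w(1) by (rule Bochner_Integration.integrable_bound) (auto simp: norm_mult)
  have "c k = (\<integral>\<theta>. of_real (w \<theta>) * cis (pairing k \<theta>) \<partial>dm)" if "k \<in> \<Lambda>" for k
    using w c[OF that] by (subst (asm) integral_density) (auto simp: scaleR_conv_of_real)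
  then have "cinner \<Lambda> c r = (\<Sum>k\<in>\<Lambda>. (\<integral>\<theta>. of_real (w \<theta>) * cis (pairing k \<theta>) * cnj (r k) \<partial>dm))"
    by (simp add: cinner_def)
  also have "\<dots> = (\<integral>\<theta>. (\<Sum>k\<in>\<Lambda>. of_real (w \<theta>) * cis (pairing k \<theta>) * cnj (r k)) \<partial>dm)"
    using int by (subst Bochner_Integration.integral_sum) auto
  also have "Re \<dots> = (\<integral>\<theta>. Re (\<Sum>k\<in>\<Lambda>. of_real (w \<theta>) * cis (pairing k \<theta>) * cnj (r k)) \<partial>dm)"
    using int by (subst integral_Re) auto
  \<comment> \<open>The sum is \<open>w \<theta>\<close> times the conjugate of
    \<open>trig_poly \<Lambda> r \<theta>\<close>, and conjugation preserves the real part.\<close>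
  also have "(\<lambda>\<theta>. Re (\<Sum>k\<in>\<Lambda>. of_real (w \<theta>) * cis (pairing k \<theta>) * cnj (r k)))
      = (\<lambda>\<theta>. w \<theta> * Re (trig_poly \<Lambda> r \<theta>))"
    by (auto simp: trig_poly_def sum_distrib_left algebra_simps intro!: sum.cong)
  finally show ?thesis .
qed

text \<open>A strict comparison with each competitor gives minimality and uniqueness
  together.\<close>

lemma J_less_if_moments:
  fixes \<Lambda> :: "(int^'d) set"
  assumes \<Lambda>: "finite \<Lambda>" "0 \<in> \<Lambda>" "uminus ` \<Lambda> = \<Lambda>"
    and p: "p \<in> closed_pos_polys \<Lambda> - {\<lambda>_. 0}"
    and q: "q \<in> closed_pos_polys \<Lambda> - {\<lambda>_. 0}"
    and fin: "finite_measure (rational_measure \<Lambda> p q)"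
    and c: "\<And>k. k \<in> \<Lambda> \<Longrightarrow> c k = (\<integral>\<theta>. cis (pairing k \<theta>) \<partial>rational_measure \<Lambda> p q)"
    and r: "r \<in> closed_pos_polys \<Lambda>" "r \<noteq> q"
  shows "J \<Lambda> c p q < J \<Lambda> c p r"
proof -
  define P where "P \<theta> = Re (trig_poly \<Lambda> p \<theta>)" for \<theta>
  define Q where "Q \<theta> = Re (trig_poly \<Lambda> q \<theta>)" for \<theta>
  define R where "R \<theta> = Re (trig_poly \<Lambda> r \<theta>)" for \<theta>
  have [measurable]: "P \<in> borel_measurable dm" "Q \<in> borel_measurable dm" "R \<in> borel_measurable dm"
    unfolding P_def Q_def R_def by measurable
  have nonneg: "0 \<le> P \<theta>" "0 \<le> Q \<theta>" "0 \<le> R \<theta>" if "\<theta> \<in> torus" for \<theta>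
    using p q r \<Lambda> that by (auto simp: closed_pos_polys_eq_nonneg P_def Q_def R_def)
  have P_pos: "AE \<theta> in dm. 0 < P \<theta>" and Q_pos: "AE \<theta> in dm. 0 < Q \<theta>"
    unfolding P_def Q_def using \<Lambda> p q by (auto intro!: AE_closed_pos_poly_pos)
  have int_PQ: "integrable dm (\<lambda>\<theta>. P \<theta> / Q \<theta>)"
  proof -
    have "(\<integral>\<^sup>+\<theta>. ennreal (P \<theta> / Q \<theta>) \<partial>dm) = emeasure (rational_measure \<Lambda> p q) torus"
      unfolding rational_measure_def P_def[symmetric] Q_def[symmetric]
      by (subst emeasure_density) (auto simp: space_dm[symmetric] simp del: space_dm
          intro!: nn_integral_cong)
    also have "\<dots> < \<infinity>"
      using finite_measure.emeasure_finite[OF fin] by (simp add: top.not_eq_extremum)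
    finally show ?thesis
      using nonneg by (intro integrableI_nonneg) (auto intro!: AE_I2)
  qed
  have P_integrable: "integrable dm P"
    using integrable_mult_trig_poly[of dm "\<lambda>_. 1" \<Lambda> p] by (simp add: P_def[abs_def])
  have PQ_integrable: "integrable dm (\<lambda>\<theta>. P \<theta> * Q \<theta>)" and PR_integrable: "integrable dm (\<lambda>\<theta>. P \<theta> * R \<theta>)"
    unfolding Q_def R_def using P_integrable by (auto intro!: integrable_mult_trig_poly)
  have inner: "Re (cinner \<Lambda> c s) = (\<integral>\<theta>. P \<theta> / Q \<theta> * Re (trig_poly \<Lambda> s \<theta>) \<partial>dm)" for s
    using int_PQ c nonneg
    by (intro Re_cinner_moments) (auto simp: rational_measure_def P_def Q_def intro!: AE_I2)
  have inner_q: "Re (cinner \<Lambda> c q) = (\<integral>\<theta>. P \<theta> \<partial>dm)"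
    \<comment> \<open>For \<open>s = q\<close> the factor \<open>Q\<close> cancels wherever it is
      positive.\<close>
    unfolding inner Q_def[symmetric] using Q_pos
    by (intro integral_cong_AE) (auto elim!: eventually_mono)
  have ln_Q: "integrable dm (\<lambda>\<theta>. P \<theta> * ln (Q \<theta>))"
  proof (rule Bochner_Integration.integrable_bound)
    show "integrable dm (\<lambda>\<theta>. P \<theta> * Q \<theta> + P \<theta> / Q \<theta>)"
      using PQ_integrable int_PQ by simp
    show "AE \<theta> in dm. norm (P \<theta> * ln (Q \<theta>)) \<le> norm (P \<theta> * Q \<theta> + P \<theta> / Q \<theta>)"
      using P_pos Q_pos
    proof eventually_elim
      case (elim \<theta>)
      \<comment> \<open>The bound \<open>ln x \<le> x\<close> is applied at
        \<open>Q \<theta>\<close> and at its reciprocal; the latter controls the logarithm near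
        zeros of \<open>Q\<close>.\<close>
      have "ln (Q \<theta>) \<le> Q \<theta>" "- ln (Q \<theta>) \<le> 1 / Q \<theta>"
        using elim ln_bound[of "Q \<theta>"] ln_bound[of "1 / Q \<theta>"] by (auto simp: ln_div)
      then have "\<bar>ln (Q \<theta>)\<bar> \<le> Q \<theta> + 1 / Q \<theta>"
        using elim by (smt (verit) divide_pos_pos)
      then have "P \<theta> * \<bar>ln (Q \<theta>)\<bar> \<le> P \<theta> * (Q \<theta> + 1 / Q \<theta>)"
        using elim by (intro mult_left_mono) auto
      then show ?case
        using elim by (simp add: abs_mult distrib_left)
    qed
  qed measurable
  have J_q: "J \<Lambda> c p q = ereal ((\<integral>\<theta>. P \<theta> \<partial>dm) - (\<integral>\<theta>. P \<theta> * ln (Q \<theta>) \<partial>dm))"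
    using q ext_integral_eq_integral[OF ln_Q] by (simp add: J_def inner_q P_def Q_def)
  \<comment> \<open>\<open>J\<close> at \<open>r\<close> is infinite by convention, infinite by
    divergence of the logarithmic integral, or finite.\<close>
  consider "r = (\<lambda>_. 0)" | "r \<noteq> (\<lambda>_. 0)" "\<not> integrable dm (\<lambda>\<theta>. P \<theta> * ln (R \<theta>))"
    | "r \<noteq> (\<lambda>_. 0)" "integrable dm (\<lambda>\<theta>. P \<theta> * ln (R \<theta>))"
    by blast
  then show ?thesis
  proof cases
    case 1
    then show ?thesis
      by (simp add: J_q) (simp add: J_def)
  next
    case 2
    have "ext_integral dm (\<lambda>\<theta>. P \<theta> * ln (R \<theta>)) = - \<infinity>"
    proof (rule ext_integral_eq_MInfty[OF _ PR_integrable _ 2(2)])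
      fix \<theta> :: "real^'d" assume "\<theta> \<in> space dm"
      then have "0 \<le> P \<theta>" "0 \<le> R \<theta>"
        using nonneg by auto
      then show "P \<theta> * ln (R \<theta>) \<le> P \<theta> * R \<theta>"
        \<comment> \<open>At zeros of \<open>R\<close> the convention \<open>ln 0 = 0\<close> makes
          both sides zero.\<close>
        by (cases "R \<theta> = 0") (auto intro!: mult_left_mono ln_bound)
    qed measurable
    then show ?thesis
      using 2(1) by (simp add: J_q) (simp add: J_def P_def R_def)
  next
    case 3
    have R_pos: "AE \<theta> in dm. 0 < R \<theta>"
      unfolding R_def using \<Lambda> r 3 by (intro AE_closed_pos_poly_pos) auto
    have int_R: "integrable dm (\<lambda>\<theta>. P \<theta> / Q \<theta> * R \<theta>)"
      unfolding R_def using int_PQ by (rule integrable_mult_trig_poly) measurable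
    \<comment> \<open>The integral of \<open>G\<close> is \<open>J\<close> at \<open>r\<close> minus
      \<open>J\<close> at \<open>q\<close>. Where \<open>Q\<close> and \<open>R\<close> are
      positive, \<open>G\<close> equals \<open>P * (x - 1 - ln x)\<close> with
      \<open>x = R / Q\<close>.\<close>
    define G where "G \<theta> = P \<theta> / Q \<theta> * R \<theta> - P \<theta> * ln (R \<theta>) - (P \<theta> - P \<theta> * ln (Q \<theta>))" for \<theta>
    have int_G: "integrable dm G"
      unfolding G_def using int_R 3 P_integrable ln_Q by simp
    have G_pos: "AE \<theta> in dm. 0 < G \<theta>"
    proof -
      have "AE \<theta> in dm. trig_poly \<Lambda> (\<lambda>k. r k - q k) \<theta> \<noteq> 0"
        using r q \<Lambda>
        by (intro AE_trig_poly_neq_0)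
          (auto simp: closed_pos_polys_eq_nonneg hermitian_families_def fun_eq_iff)
      with P_pos Q_pos R_pos show ?thesis
      proof eventually_elim
        case (elim \<theta>)
        \<comment> \<open>The difference is known to be nonzero as a complex number; realness of
          both values transfers this to \<open>R\<close> and \<open>Q\<close>.\<close>
        have "trig_poly \<Lambda> r \<theta> \<in> \<real>" "trig_poly \<Lambda> q \<theta> \<in> \<real>"
          using r q \<Lambda> by (auto simp: closed_pos_polys_eq_nonneg intro!: trig_poly_real)
        then have "R \<theta> \<noteq> Q \<theta>"
          using elim by (auto simp: trig_poly_diff R_def Q_def elim!: Reals_cases)
        \<comment> \<open>Equality in \<open>ln x \<le> x - 1\<close> holds only at
          \<open>x = 1\<close>.\<close>
        then have "ln (R \<theta> / Q \<theta>) < R \<theta> / Q \<theta> - 1"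
          using elim ln_le_minus_one[of "R \<theta> / Q \<theta>"] ln_eq_minus_one[of "R \<theta> / Q \<theta>"]
          by (force simp: order.order_iff_strict)
        then have "0 < P \<theta> * (R \<theta> / Q \<theta> - 1 - ln (R \<theta> / Q \<theta>))"
          using elim by simp
        also have "\<dots> = G \<theta>"
          using elim by (simp add: G_def ln_div algebra_simps)
        finally show ?case .
      qed
    qed
    have "0 \<le> integral\<^sup>L dm G"
      using G_pos by (intro integral_nonneg_AE) (auto elim: eventually_mono)
    \<comment> \<open>A zero integral would force \<open>G = 0\<close> almost everywhere, against
      \<open>G_pos\<close>.\<close>
    moreover have "integral\<^sup>L dm G \<noteq> 0"
    proof
      assume "integral\<^sup>L dm G = 0"
      then have "AE \<theta> in dm. G \<theta> = 0"
        using int_G G_pos by (subst (asm) integral_nonneg_eq_0_iff_AE) (auto elim: eventually_mono)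
      with G_pos have "AE \<theta> in (dm :: (real^'d) measure). False"
        by eventually_elim simp
      then show False
        using not_AE_dm_False by blast
    qed
    moreover have "J \<Lambda> c p r = ereal ((\<integral>\<theta>. P \<theta> / Q \<theta> * R \<theta> \<partial>dm) - (\<integral>\<theta>. P \<theta> * ln (R \<theta>) \<partial>dm))"
      using 3 ext_integral_eq_integral[OF 3(2)] by (simp add: J_def inner P_def Q_def R_def)
    moreover have "integral\<^sup>L dm G = (\<integral>\<theta>. P \<theta> / Q \<theta> * R \<theta> \<partial>dm) - (\<integral>\<theta>. P \<theta> * ln (R \<theta>) \<partial>dm)
        - ((\<integral>\<theta>. P \<theta> \<partial>dm) - (\<integral>\<theta>. P \<theta> * ln (Q \<theta>) \<partial>dm))"
      unfolding G_def using int_R 3 P_integrable ln_Q by simp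
    ultimately show ?thesis
      by (simp add: J_q)
  qed
qed

theorem corollary2p2:
  fixes \<Lambda> :: "(int^'d) set"
    and c p q :: "int^'d \<Rightarrow> complex"
    and \<mu> :: "(real^'d) measure"
  assumes "finite \<Lambda>" and "0 \<in> \<Lambda>" and "uminus ` \<Lambda> = \<Lambda>"
    and "c \<in> dual_cone \<Lambda>"
    and "p \<in> closed_pos_polys \<Lambda> - {\<lambda>_. 0}"
    and "q \<in> closed_pos_polys \<Lambda> - {\<lambda>_. 0}"
    and "\<mu> = rational_measure \<Lambda> p q"
    and "finite_measure \<mu>"
    and "\<And>k. k \<in> \<Lambda> \<Longrightarrow> c k = (\<integral>\<theta>. cis (pairing k \<theta>) \<partial>\<mu>)"
  shows "is_arg_min (J \<Lambda> c p) (\<lambda>r. r \<in> closed_pos_polys \<Lambda>) q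
    \<and> (\<forall>r. is_arg_min (J \<Lambda> c p) (\<lambda>r. r \<in> closed_pos_polys \<Lambda>) r \<longrightarrow> r = q)"
proof -
  have "J \<Lambda> c p q < J \<Lambda> c p r" if "r \<in> closed_pos_polys \<Lambda>" "r \<noteq> q" for r
    using assms that by (intro J_less_if_moments) auto
  then show ?thesis
    using assms(6) unfolding is_arg_min_def by (metis DiffD1 less_asym less_irrefl)
qed

end
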